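(* Let $\mathbb{K}=\mathbb{R}$ or $\mathbb{K}=\mathbb{C}$. There is a universal constant $L_{\mathbb{K}}>0$ (depending only on $\mathbb{K}$, and not on $m$, $n$, $r$ or $P$) such that for all positive integers $m,n$, all real $r\in\left[1,\frac{2m}{m+1}\right]$ and all $m$-homogeneous polynomials $P:\ell_\infty^n(\mathbb{K})\to\mathbb{K}$, $$\|P\|_r\le L_{\mathbb{K}}^m\cdot n^{\frac{m}{r}-\frac{m+1}{2}}\,\|P\|_\infty .$$ Moreover, the power $\frac{m}{r}-\frac{m+1}{2}$ of $n$ is optimal: for every positive integer $m$, every $r\in\left[1,\frac{2m}{m+1}\right]$ and every real $q<\frac{m}{r}-\frac{m+1}{2}$, there is no constant $C>0$ such that $\|P\|_r\le C^m\, n^{q}\,\|P\|_\infty$ holds for all positive integers $n$ and all $m$-homogeneous polynomials $P:\ell_\infty^n(\mathbb{K})\to\mathbb{K}$.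
   Context: $\ell_\infty^n(\mathbb{K})$ denotes $\mathbb{K}^n$ with the supremum norm. An $m$-homogeneous polynomial $P:\ell_\infty^n(\mathbb{K})\to\mathbb{K}$ is a function of the form $P(z)=\sum_{|\alpha|=m}a_\alpha z^\alpha$ with coefficients $a_\alpha\in\mathbb{K}$, where the sum runs over multi-indices $\alpha=(\alpha_1,\dots,\alpha_n)$ of nonnegative integers with $|\alpha|=\alpha_1+\cdots+\alpha_n=m$, and $z^\alpha=z_1^{\alpha_1}\cdots z_n^{\alpha_n}$. For $r\ge 1$, $\|P\|_r:=\left(\sum_{|\alpha|=m}|a_\alpha|^r\right)^{1/r}$ is the $\ell_r$ norm of the coefficients, and $\|P\|_\infty:=\sup\{|P(z)|: z\in\mathbb{K}^n,\ \max_{1\le i\le n}|z_i|\le 1\}$ is the supremum norm of $P$ on the unit ball of $\ell_\infty^n(\mathbb{K})$ (for $\mathbb{K}=\mathbb{C}$ this is the unit polydisc, for $\mathbb{K}=\mathbb{R}$ the cube $[-1,1]^n$). *)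

theory Defs
  imports "HOL-Analysis.Analysis"
begin

text \<open>
  The dimension \<open>n\<close> varies inside the statement, so vectors of the
  \<open>n\<close>-dimensional space over a field \<open>'k\<close> are functions in
  \<open>{..<n} \<rightarrow>\<^sub>E UNIV\<close>, with coordinates numbered from \<open>0\<close>;
  multi-indices are treated in the same way.
\<close>

definition multi_indices :: "nat \<Rightarrow> nat \<Rightarrow> (nat \<Rightarrow> nat) set" where
  "multi_indices n m = {\<alpha> \<in> {..<n} \<rightarrow>\<^sub>E UNIV. (\<Sum>i<n. \<alpha> i) = m}"

definition hom_poly ::
    "nat \<Rightarrow> nat \<Rightarrow> ((nat \<Rightarrow> nat) \<Rightarrow> 'k) \<Rightarrow> (nat \<Rightarrow> 'k) \<Rightarrow> 'k::real_normed_field" where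
  "hom_poly n m a z = (\<Sum>\<alpha>\<in>multi_indices n m. a \<alpha> * (\<Prod>i<n. z i ^ \<alpha> i))"

text \<open>
  Only the values of \<open>a\<close> on \<open>multi_indices n m\<close> matter.  Over an infinite field
  these are determined by the function \<open>hom_poly n m a\<close>, so the following is indeed a norm
  of the polynomial.
\<close>

definition coeff_norm ::
    "nat \<Rightarrow> nat \<Rightarrow> real \<Rightarrow> ((nat \<Rightarrow> nat) \<Rightarrow> 'k::real_normed_field) \<Rightarrow> real" where
  "coeff_norm n m r a = (\<Sum>\<alpha>\<in>multi_indices n m. norm (a \<alpha>) powr r) powr (1 / r)"

definition sup_norm :: "nat \<Rightarrow> ((nat \<Rightarrow> 'k) \<Rightarrow> 'k::real_normed_field) \<Rightarrow> real" where
  "sup_norm n P = (SUP z\<in>{..<n} \<rightarrow>\<^sub>E cball 0 1. norm (P z))"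

end

theory Submission
  imports Defs "HOL-Complex_Analysis.Complex_Analysis"
begin

text \<open>
Upper bound over \<open>\<complex>\<close>.  The case \<open>r = \<rho> := 2m/(m+1)\<close> is the Bohnenblust--Hille inequality with a
constant of the form \<open>L ^ m\<close>.  It is proved through the Euler derivatives
\<open>D\<^sub>l P = z\<^sub>l \<partial>P/\<partial>z\<^sub>l = \<Sum>\<^sub>\<alpha> \<alpha>\<^sub>l a\<^sub>\<alpha> z\<^sup>\<alpha>\<close>, which are again \<open>m\<close>-homogeneous and have the same
multi-indices as \<open>P\<close>.  Three facts are combined.

\<^item> If \<open>A\<^sub>l\<close> is the \<open>\<ell>\<^sub>2\<close> norm of the coefficients of \<open>D\<^sub>l P\<close>, then \<open>\<parallel>P\<parallel>\<^sub>\<rho> \<le> \<Sum>\<^sub>l A\<^sub>l\<close>.  This is a form of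
  Blei's inequality written directly in multi-indices; it follows from the weighted inequality of
  the means applied to each coefficient (\<open>sum_powr_coefficients_le_one\<close>).
\<^item> The \<open>\<ell>\<^sub>2\<close> norm of the coefficients of an \<open>m\<close>-homogeneous \<open>Q\<close> is at most \<open>2 ^ m\<close> times the mean of
  \<open>\<bar>Q\<bar>\<close> over the torus.  By Hoelder's inequality it suffices to compare the fourth moment with the
  second, and this is Parseval's identity for \<open>Q\<^sup>2\<close>: a multi-index of degree \<open>2m\<close> splits in at
  most \<open>4 ^ m\<close> ways into two of degree \<open>m\<close>.  The torus is replaced by a grid of roots of unity,
  so that every mean is a finite sum (\<open>l2_norm_le_torus_mean\<close>).
\<^item> \<open>\<Sum>\<^sub>l \<bar>D\<^sub>l P(z)\<bar> \<le> 2 ^ m \<parallel>P\<parallel>\<^sub>\<infinity>\<close> on the polydisc: for suitable \<open>\<bar>w\<^sub>l\<bar> \<le> 1\<close> the sum is the derivative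
  at \<open>0\<close> of \<open>t \<mapsto> P((1 + t w\<^sub>l) z\<^sub>l)\<^sub>l\<close>, which Cauchy's estimate bounds
  (\<open>sum_euler_derivatives_le\<close>).

Hence \<open>\<parallel>P\<parallel>\<^sub>\<rho> \<le> \<Sum>\<^sub>l A\<^sub>l \<le> 4 ^ m \<parallel>P\<parallel>\<^sub>\<infinity>\<close>.  For \<open>r < \<rho>\<close>, Hoelder's inequality costs the factor
\<open>M powr (1/r - 1/\<rho>)\<close>, where \<open>M \<le> n ^ m\<close> is the number of multi-indices, and
\<open>m (1/r - 1/\<rho>) = m/r - (m+1)/2\<close>.

Upper bound over \<open>\<real>\<close>.  The coefficients are those of the complexified polynomial, whose
norm on the polydisc is at most \<open>(2 (1 + sqrt 2)) ^ m\<close> times the norm on the cube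
(\<open>sup_norm_complexification_le\<close>).

Optimality.  Let \<open>n\<close> be a power of \<open>2\<close> and \<open>h\<close> the Sylvester--Hadamard matrix of order \<open>n\<close>.  In \<open>m\<close>
blocks of \<open>n\<close> variables, the \<open>m\<close>-linear form with coefficients
\<open>h(t\<^sub>0,t\<^sub>1) h(t\<^sub>1,t\<^sub>2) \<dots> h(t\<^bsub>m-2\<^esub>,t\<^bsub>m-1\<^esub>)\<close> has \<open>n ^ m\<close> coefficients \<open>\<plusminus>1\<close>, and as \<open>h\<close> multiplies Euclidean
norms by \<open>sqrt n\<close>, its supremum norm is at most \<open>n powr ((m+1)/2)\<close>.  As an \<open>m\<close>-homogeneous polynomial
in \<open>m n\<close> variables it forces \<open>q \<ge> m/r - (m+1)/2\<close> when \<open>n\<close> tends to infinity.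
\<close>

section \<open>Multi-indices\<close>

lemma multi_indices_le:
  assumes "\<alpha> \<in> multi_indices n m" "i < n"
  shows "\<alpha> i \<le> m"
  using assms member_le_sum[of i "{..<n}" \<alpha>] by (auto simp: multi_indices_def)

lemma finite_multi_indices: "finite (multi_indices n m)"
proof (rule finite_subset)
  show "multi_indices n m \<subseteq> {..<n} \<rightarrow>\<^sub>E {..m}"
  proof
    fix \<alpha> assume \<alpha>: "\<alpha> \<in> multi_indices n m"
    then have "\<alpha> \<in> {..<n} \<rightarrow>\<^sub>E UNIV"
      by (simp add: multi_indices_def)
    then show "\<alpha> \<in> {..<n} \<rightarrow>\<^sub>E {..m}"
      using multi_indices_le[OF \<alpha>] by (simp add: PiE_iff)
  qed
  show "finite ({..<n} \<rightarrow>\<^sub>E {..m})"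
    by (intro finite_PiE) auto
qed

lemma multi_indices_0: "multi_indices n 0 = {\<lambda>i\<in>{..<n}. 0}"
  by (force simp: multi_indices_def PiE_iff extensional_def)

text \<open>
Any multi-index of positive degree arises by raising one exponent of a multi-index of the next
lower degree.  This is the step of inductions on the degree.
\<close>

lemma multi_indices_Suc_subset:
  "multi_indices n (Suc m) \<subseteq> (\<lambda>(i, \<beta>). \<beta>(i := Suc (\<beta> i))) ` ({..<n} \<times> multi_indices n m)"
proof
  fix \<alpha> assume \<alpha>: "\<alpha> \<in> multi_indices n (Suc m)"
  then obtain i where i: "i < n" "\<alpha> i \<noteq> 0"
    by (force simp: multi_indices_def)
  have "(\<Sum>j<n. (\<alpha>(i := \<alpha> i - 1)) j) + 1 = (\<Sum>j<n. \<alpha> j)"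
    using i by (simp add: sum.remove[of "{..<n}" i])
  then have "\<alpha>(i := \<alpha> i - 1) \<in> multi_indices n m"
    using \<alpha> i by (auto simp: multi_indices_def PiE_iff extensional_def)
  moreover have "\<alpha> = (\<alpha>(i := \<alpha> i - 1))(i := Suc ((\<alpha>(i := \<alpha> i - 1)) i))"
    using i by auto
  ultimately show "\<alpha> \<in> (\<lambda>(i, \<beta>). \<beta>(i := Suc (\<beta> i))) ` ({..<n} \<times> multi_indices n m)"
    using i by (intro image_eqI[of _ _ "(i, \<alpha>(i := \<alpha> i - 1))"]) auto
qed

text \<open>
Expanding the power on the right produces each monomial with a multinomial coefficient, which is
at least one.
\<close>

lemma sum_monomials_le_power_sum:
  fixes A :: "nat \<Rightarrow> real"
  assumes A: "\<And>i. i < n \<Longrightarrow> 0 \<le> A i"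
  shows "(\<Sum>\<alpha>\<in>multi_indices n m. \<Prod>i<n. A i ^ \<alpha> i) \<le> (\<Sum>i<n. A i) ^ m"
proof (induction m)
  case 0
  then show ?case by (simp add: multi_indices_0)
next
  case (Suc m)
  define G where "G = (\<lambda>\<alpha>. \<Prod>i<n. A i ^ \<alpha> i)"
  have G_nonneg: "0 \<le> G \<alpha>" for \<alpha>
    using A by (auto simp: G_def intro!: prod_nonneg)
  have G_upd: "G (\<beta>(i := Suc (\<beta> i))) = A i * G \<beta>" if "i < n" for i \<beta>
    using that by (simp add: G_def prod.remove[of "{..<n}" i])
  have "(\<Sum>\<alpha>\<in>multi_indices n (Suc m). G \<alpha>)
      \<le> sum G ((\<lambda>(i, \<beta>). \<beta>(i := Suc (\<beta> i))) ` ({..<n} \<times> multi_indices n m))"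
    using multi_indices_Suc_subset G_nonneg
    by (intro sum_mono2) (auto simp: finite_multi_indices)
  also have "\<dots> \<le> sum (G \<circ> (\<lambda>(i, \<beta>). \<beta>(i := Suc (\<beta> i)))) ({..<n} \<times> multi_indices n m)"
    by (rule sum_image_le) (auto simp: finite_multi_indices G_nonneg)
  also have "\<dots> = (\<Sum>(i, \<beta>)\<in>{..<n} \<times> multi_indices n m. A i * G \<beta>)"
    by (rule sum.cong) (auto simp: G_upd)
  also have "\<dots> = (\<Sum>i<n. A i) * (\<Sum>\<beta>\<in>multi_indices n m. G \<beta>)"
    by (simp add: sum_product sum.cartesian_product)
  also have "\<dots> \<le> (\<Sum>i<n. A i) * (\<Sum>i<n. A i) ^ m"
    using Suc A by (intro mult_left_mono sum_nonneg) (auto simp: G_def)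
  finally show ?case by (simp add: G_def)
qed

corollary card_multi_indices_le: "card (multi_indices n m) \<le> n ^ m"
proof -
  have "real (card (multi_indices n m)) \<le> real (n ^ m)"
    using sum_monomials_le_power_sum[of n "\<lambda>_. 1" m] by simp
  then show ?thesis by (simp only: of_nat_le_iff)
qed

section \<open>A Blei-type inequality for coefficients\<close>

text \<open>
A form of Blei's inequality for multi-indices.  As \<open>\<Sum>l. \<alpha> l = m\<close>, the identity
\<open>a \<alpha> ^ (2m) = (\<Prod>l. ((a \<alpha>)\<^sup>2 / A l) ^ \<alpha> l) * (\<Prod>l. A l ^ \<alpha> l)\<close>
expresses \<open>a \<alpha> powr (2m/(m+1))\<close> as a weighted geometric mean of the numbers \<open>(a \<alpha>)\<^sup>2 / A l\<close>, with
weights \<open>\<alpha> l / (m+1)\<close>, and of the monomial \<open>\<Prod>l. A l ^ \<alpha> l\<close>, with weight \<open>1/(m+1)\<close>.  Bounding it by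
the arithmetic mean and summing over \<open>\<alpha>\<close>, the first terms give at most \<open>\<Sum>l. (A l)\<^sup>2 / A l\<close> and
the monomials at most \<open>(\<Sum>l. A l) ^ m\<close>.
\<close>

lemma sum_powr_coefficients_le_one:
  fixes a :: "(nat \<Rightarrow> nat) \<Rightarrow> real" and A :: "nat \<Rightarrow> real"
  assumes a: "\<And>\<alpha>. \<alpha> \<in> multi_indices n m \<Longrightarrow> 0 \<le> a \<alpha>"
    and A: "\<And>l. l < n \<Longrightarrow> 0 \<le> A l"
    and A_bound: "\<And>l. l < n \<Longrightarrow> (\<Sum>\<alpha>\<in>multi_indices n m. real (\<alpha> l) * (a \<alpha>)\<^sup>2) \<le> (A l)\<^sup>2"
    and sum_A: "(\<Sum>l<n. A l) \<le> 1"
    and m: "m \<ge> 1"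
  shows "(\<Sum>\<alpha>\<in>multi_indices n m. a \<alpha> powr (2 * real m / (real m + 1))) \<le> 1"
proof -
  define \<rho> where "\<rho> = 2 * real m / (real m + 1)"
  define G where "G = (\<lambda>\<alpha>. \<Prod>l<n. A l ^ \<alpha> l)"
  have pointwise: "(real m + 1) * a \<alpha> powr \<rho> \<le> (\<Sum>l<n. real (\<alpha> l) * ((a \<alpha>)\<^sup>2 / A l)) + G \<alpha>"
    if \<alpha>: "\<alpha> \<in> multi_indices n m" for \<alpha>
  proof (cases "a \<alpha> = 0")
    case True
    then show ?thesis
      using A by (auto simp: G_def intro!: prod_nonneg)
  next
    case False
    then have a_pos: "a \<alpha> > 0" using a[OF \<alpha>] by simp
    \<comment> \<open>As \<open>a \<alpha>\<close> is nonzero, \<open>A l\<close> can vanish only where \<open>\<alpha> l = 0\<close>,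
      so it never enters the geometric mean.\<close>
    have A_pos: "A l > 0" if "l < n" "\<alpha> l \<noteq> 0" for l
    proof -
      have "0 < real (\<alpha> l) * (a \<alpha>)\<^sup>2" using that a_pos by simp
      also have "\<dots> \<le> (\<Sum>\<alpha>\<in>multi_indices n m. real (\<alpha> l) * (a \<alpha>)\<^sup>2)"
        using \<alpha> by (intro member_le_sum[where f = "\<lambda>\<alpha>. real (\<alpha> l) * (a \<alpha>)\<^sup>2"])
          (auto simp: finite_multi_indices)
      also have "\<dots> \<le> (A l)\<^sup>2" by (rule A_bound) fact
      finally show ?thesis using A[OF \<open>l < n\<close>] by (cases "A l = 0") auto
    qed
    define b where "b = a \<alpha> powr \<rho>"
    have b_pos: "b > 0" using a_pos by (simp add: b_def)
    have ln_b: "(real m + 1) * ln b = 2 * real m * ln (a \<alpha>)"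
      using a_pos by (simp add: b_def \<rho>_def ln_powr)
    have sum_\<alpha>: "(\<Sum>l<n. real (\<alpha> l)) = real m"
      using \<alpha> by (auto simp: multi_indices_def simp flip: of_nat_sum)
    have pow_pos: "A l ^ \<alpha> l > 0" if "l < n" for l
      using A_pos[OF that] by (cases "\<alpha> l = 0") auto
    then have "G \<alpha> > 0"
      unfolding G_def by (intro prod_pos) auto
    have "ln (G \<alpha>) = (\<Sum>l<n. ln (A l ^ \<alpha> l))"
      unfolding G_def by (rule ln_prod) (simp, metis pow_pos lessThan_iff less_irrefl)
    also have "\<dots> = (\<Sum>l<n. real (\<alpha> l) * ln (A l))"
    proof (rule sum.cong)
      fix l assume "l \<in> {..<n}"
      then show "ln (A l ^ \<alpha> l) = real (\<alpha> l) * ln (A l)"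
        using A_pos by (cases "\<alpha> l = 0") (auto simp: ln_realpow)
    qed simp
    finally have ln_G: "ln (G \<alpha>) = (\<Sum>l<n. real (\<alpha> l) * ln (A l))" .
    \<comment> \<open>The inequality of the means is proved by the tangent of \<open>ln\<close> at the geometric mean \<open>b\<close>.\<close>
    have tangent: "1 + (ln y - ln b) \<le> y / b" if "y > 0" for y
      using ln_le_minus_one[of "y / b"] that b_pos by (simp add: ln_div)
    have "real m + 1 = (\<Sum>l<n. real (\<alpha> l) * (1 + (2 * ln (a \<alpha>) - ln (A l) - ln b)))
             + (1 + (ln (G \<alpha>) - ln b))"
      using ln_b
      by (simp add: algebra_simps sum.distrib sum_subtractf ln_G sum_\<alpha> flip: sum_distrib_left sum_distrib_right)
    also have "\<dots> \<le> (\<Sum>l<n. real (\<alpha> l) * ((a \<alpha>)\<^sup>2 / A l / b)) + G \<alpha> / b"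
    proof (intro add_mono sum_mono)
      fix l assume "l \<in> {..<n}"
      show "real (\<alpha> l) * (1 + (2 * ln (a \<alpha>) - ln (A l) - ln b)) \<le> real (\<alpha> l) * ((a \<alpha>)\<^sup>2 / A l / b)"
      proof (cases "\<alpha> l = 0")
        case False
        then have "A l > 0" using A_pos \<open>l \<in> {..<n}\<close> by simp
        then show ?thesis
          using tangent[of "(a \<alpha>)\<^sup>2 / A l"] a_pos
          by (intro mult_left_mono) (simp_all add: ln_div ln_realpow)
      qed simp
    qed (use tangent \<open>G \<alpha> > 0\<close> in auto)
    also have "\<dots> = ((\<Sum>l<n. real (\<alpha> l) * ((a \<alpha>)\<^sup>2 / A l)) + G \<alpha>) / b"
      by (simp add: sum_divide_distrib add_divide_distrib)
    finally show ?thesis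
      using b_pos by (simp add: b_def pos_le_divide_eq)
  qed
  have "(real m + 1) * (\<Sum>\<alpha>\<in>multi_indices n m. a \<alpha> powr \<rho>)
      \<le> (\<Sum>\<alpha>\<in>multi_indices n m. (\<Sum>l<n. real (\<alpha> l) * ((a \<alpha>)\<^sup>2 / A l)) + G \<alpha>)"
    unfolding sum_distrib_left by (intro sum_mono pointwise)
  also have "\<dots> = (\<Sum>l<n. (\<Sum>\<alpha>\<in>multi_indices n m. real (\<alpha> l) * (a \<alpha>)\<^sup>2) / A l) + (\<Sum>\<alpha>\<in>multi_indices n m. G \<alpha>)"
    by (simp add: sum.distrib sum_divide_distrib sum.swap[of _ _ "multi_indices n m"])
  also have "\<dots> \<le> (\<Sum>l<n. (A l)\<^sup>2 / A l) + (\<Sum>l<n. A l) ^ m"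
    using A A_bound unfolding G_def
    by (intro add_mono sum_mono divide_right_mono sum_monomials_le_power_sum) auto
  also have "\<dots> \<le> 1 + 1"
    using A sum_A by (intro add_mono power_le_one) (auto simp: power2_eq_square intro!: sum_nonneg)
  also have "\<dots> \<le> real m + 1" using m by simp
  finally show ?thesis by (simp add: \<rho>_def)
qed

text \<open>
Hoelder's inequality for an index set of at most \<open>M\<close> elements, normalised so that it follows
from Young's inequality for the pair \<open>(b i powr \<rho> * M, 1)\<close> term by term.
\<close>

lemma lr_norm_le_of_lrho_norm_le_one:
  fixes b :: "'i \<Rightarrow> real"
  assumes fin: "finite I" and b: "\<And>i. i \<in> I \<Longrightarrow> 0 \<le> b i"
    and r: "0 < r" "r \<le> \<rho>" and le1: "(\<Sum>i\<in>I. b i powr \<rho>) \<le> 1"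
    and M: "real (card I) \<le> M" "0 < M"
  shows "(\<Sum>i\<in>I. b i powr r) powr (1 / r) \<le> M powr (1 / r - 1 / \<rho>)"
proof -
  have \<rho>: "\<rho> > 0" using r by simp
  have pointwise: "b i powr r * M powr (r / \<rho>) \<le> r / \<rho> * (b i powr \<rho> * M) + (1 - r / \<rho>)"
    if "i \<in> I" for i
  proof (cases "b i = 0")
    case True
    then show ?thesis using r \<rho> by simp
  next
    case False
    then have "b i > 0" using b[OF that] by simp
    then have eq: "b i powr r * M powr (r / \<rho>) = (b i powr \<rho> * M) powr (r / \<rho>) * 1 powr (1 - r / \<rho>)"
      using \<rho> M by (simp add: powr_mult powr_powr)
    show ?thesis
      unfolding eq
      using Youngs_inequality_0[of "r / \<rho>" "1 - r / \<rho>" "b i powr \<rho> * M" 1] r \<rho> M \<open>b i > 0\<close>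
      by simp
  qed
  have "(\<Sum>i\<in>I. b i powr r) * M powr (r / \<rho>) \<le> (\<Sum>i\<in>I. r / \<rho> * (b i powr \<rho> * M) + (1 - r / \<rho>))"
    unfolding sum_distrib_right by (intro sum_mono pointwise)
  also have "\<dots> = r / \<rho> * M * (\<Sum>i\<in>I. b i powr \<rho>) + (1 - r / \<rho>) * real (card I)"
    by (simp add: sum.distrib sum_distrib_left mult_ac)
  also have "\<dots> \<le> r / \<rho> * M * 1 + (1 - r / \<rho>) * M"
    using r \<rho> M le1 by (intro add_mono mult_left_mono) auto
  also have "\<dots> = M" by (simp add: algebra_simps)
  finally have "(\<Sum>i\<in>I. b i powr r) \<le> M / M powr (r / \<rho>)"
    using M by (simp add: pos_le_divide_eq)
  also have "\<dots> = M powr (1 - r / \<rho>)"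
    using M by (simp add: powr_diff)
  finally have "(\<Sum>i\<in>I. b i powr r) powr (1 / r) \<le> (M powr (1 - r / \<rho>)) powr (1 / r)"
    using r by (intro powr_mono2 sum_nonneg) auto
  also have "\<dots> = M powr (1 / r - 1 / \<rho>)"
    using r \<rho> by (simp add: powr_powr field_simps)
  finally show ?thesis .
qed

section \<open>Means over a grid on the torus\<close>

text \<open>
The point of the torus whose coordinates are the \<open>N\<close>-th roots of unity numbered by \<open>g\<close>.  Means over
all \<open>g\<close> agree with integrals over the torus for trigonometric polynomials of small degree.
\<close>

definition torus_point :: "nat \<Rightarrow> nat \<Rightarrow> (nat \<Rightarrow> nat) \<Rightarrow> nat \<Rightarrow> complex" where
  "torus_point n N g = (\<lambda>i\<in>{..<n}. cis (2 * pi * real (g i) / real N))"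

lemma norm_torus_point: "i < n \<Longrightarrow> norm (torus_point n N g i) = 1"
  by (simp add: torus_point_def)

lemma sum_roots_of_unity_orthogonal:
  assumes "j < N" "k < N"
  shows "(\<Sum>x<N. cis (2 * pi * real x / real N) ^ j * cnj (cis (2 * pi * real x / real N) ^ k))
       = (if j = k then of_nat N else 0)"
proof -
  define w where "w = cis (2 * pi * (real j - real k) / real N)"
  have N: "N > 0" using assms by simp
  have summand: "cis (2 * pi * real x / real N) ^ j * cnj (cis (2 * pi * real x / real N) ^ k) = w ^ x" for x
    by (simp add: w_def Complex.DeMoivre cis_mult cis_cnj diff_divide_distrib algebra_simps)
  show ?thesis
  proof (cases "j = k")
    case True
    then show ?thesis unfolding summand by (simp add: w_def)
  next
    case False
    have "w \<noteq> 1"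
    proof
      assume "w = 1"
      then have "cos (2 * pi * (real j - real k) / real N) = 1"
        by (simp add: w_def complex_eq_iff)
      then obtain c :: int where "2 * pi * (real j - real k) / real N = of_int c * 2 * pi"
        by (auto simp: cos_one_2pi_int)
      then have "2 * pi * ((real j - real k) / real N) = 2 * pi * of_int c" by simp
      then have "(real j - real k) / real N = of_int c"
        by (subst (asm) mult_cancel_left) simp
      then have "real j - real k = of_int c * real N"
        using N by (simp add: field_simps)
      then have "real_of_int (int j - int k) = real_of_int (c * int N)" by simp
      then have eq: "int j - int k = c * int N" by (simp only: of_int_eq_iff)
      then have "int N dvd int j - int k" by simp
      then have "int N \<le> \<bar>int j - int k\<bar>"
        using False dvd_imp_le_int[of "int j - int k" "int N"] by simp
      then show False using assms by linarith
    qed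
    have "w ^ N = 1"
      using N by (simp add: w_def Complex.DeMoivre cis_multiple_2pi)
    then show ?thesis
      unfolding summand using False \<open>w \<noteq> 1\<close> by (simp add: geometric_sum)
  qed
qed

text \<open>
Monomials whose exponents are all below \<open>N\<close> stay orthogonal on the grid, since the mean of a
product over the grid is the product of one-dimensional means.
\<close>

lemma torus_parseval:
  assumes F: "F \<subseteq> {..<n} \<rightarrow>\<^sub>E {..<N}"
  shows "(\<Sum>g\<in>{..<n} \<rightarrow>\<^sub>E {..<N}. (norm (\<Sum>\<gamma>\<in>F. c \<gamma> * (\<Prod>i<n. torus_point n N g i ^ \<gamma> i)))\<^sup>2)
       = real N ^ n * (\<Sum>\<gamma>\<in>F. (norm (c \<gamma>))\<^sup>2)"
proof -
  define G where "G = ({..<n} \<rightarrow>\<^sub>E {..<N})"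
  define M where "M = (\<lambda>g \<gamma>. \<Prod>i<n. torus_point n N g i ^ \<gamma> i)"
  have finF: "finite F" by (rule finite_subset[OF F]) (intro finite_PiE, auto)
  have orth: "(\<Sum>g\<in>G. M g \<gamma> * cnj (M g \<delta>)) = (if \<gamma> = \<delta> then of_nat N ^ n else 0)"
    if "\<gamma> \<in> F" "\<delta> \<in> F" for \<gamma> \<delta>
  proof -
    have lt: "\<gamma> i < N" "\<delta> i < N" if "i < n" for i
      using F \<open>\<gamma> \<in> F\<close> \<open>\<delta> \<in> F\<close> that by (auto simp: PiE_iff)
    have "(\<Sum>g\<in>G. M g \<gamma> * cnj (M g \<delta>))
        = (\<Sum>g\<in>G. \<Prod>i<n. cis (2 * pi * real (g i) / real N) ^ \<gamma> i
              * cnj (cis (2 * pi * real (g i) / real N) ^ \<delta> i))"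
      by (simp add: M_def torus_point_def flip: prod.distrib)
    also have "\<dots> = (\<Prod>i<n. \<Sum>x<N. cis (2 * pi * real x / real N) ^ \<gamma> i
              * cnj (cis (2 * pi * real x / real N) ^ \<delta> i))"
      unfolding G_def by (rule prod_sum_PiE[symmetric]) auto
    also have "\<dots> = (\<Prod>i<n. if \<gamma> i = \<delta> i then of_nat N else 0)"
      using lt by (intro prod.cong sum_roots_of_unity_orthogonal) auto
    also have "\<dots> = (if \<gamma> = \<delta> then of_nat N ^ n else 0)"
    proof (cases "\<gamma> = \<delta>")
      case False
      have "\<gamma> \<in> {..<n} \<rightarrow>\<^sub>E {..<N}" "\<delta> \<in> {..<n} \<rightarrow>\<^sub>E {..<N}" using F that by auto
      then obtain i where "i < n" "\<gamma> i \<noteq> \<delta> i"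
        using False PiE_ext by (metis lessThan_iff)
      then show ?thesis using False by (auto intro!: prod_zero bexI[of _ i])
    qed simp
    finally show ?thesis .
  qed
  have "of_real (\<Sum>g\<in>G. (norm (\<Sum>\<gamma>\<in>F. c \<gamma> * M g \<gamma>))\<^sup>2)
      = (\<Sum>g\<in>G. (\<Sum>\<gamma>\<in>F. c \<gamma> * M g \<gamma>) * cnj (\<Sum>\<gamma>\<in>F. c \<gamma> * M g \<gamma>))"
    by (simp only: of_real_sum complex_norm_square)
  also have "\<dots> = (\<Sum>g\<in>G. \<Sum>\<gamma>\<in>F. \<Sum>\<delta>\<in>F. c \<gamma> * cnj (c \<delta>) * (M g \<gamma> * cnj (M g \<delta>)))"
    by (simp add: sum_product mult_ac)
  also have "\<dots> = (\<Sum>\<gamma>\<in>F. \<Sum>\<delta>\<in>F. \<Sum>g\<in>G. c \<gamma> * cnj (c \<delta>) * (M g \<gamma> * cnj (M g \<delta>)))"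
    by (subst sum.swap, intro sum.cong refl sum.swap)
  also have "\<dots> = (\<Sum>\<gamma>\<in>F. \<Sum>\<delta>\<in>F. c \<gamma> * cnj (c \<delta>) * (\<Sum>g\<in>G. M g \<gamma> * cnj (M g \<delta>)))"
    by (simp add: sum_distrib_left)
  also have "\<dots> = (\<Sum>\<gamma>\<in>F. \<Sum>\<delta>\<in>F. c \<gamma> * cnj (c \<delta>) * (if \<gamma> = \<delta> then of_nat N ^ n else 0))"
    using orth by (intro sum.cong) auto
  also have "\<dots> = (\<Sum>\<gamma>\<in>F. c \<gamma> * cnj (c \<gamma>) * of_nat N ^ n)"
    using finF by (intro sum.cong refl) (simp add: if_distrib cong: if_cong)
  also have "\<dots> = of_real (real N ^ n * (\<Sum>\<gamma>\<in>F. (norm (c \<gamma>))\<^sup>2))"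
    by (simp add: sum_distrib_left mult.commute complex_norm_square[symmetric])
  finally show ?thesis
    unfolding G_def M_def of_real_eq_iff .
qed

text \<open>
Hoelder's inequality interpolating \<open>\<ell>\<^sub>2\<close> between \<open>\<ell>\<^sub>1\<close> and \<open>\<ell>\<^sub>4\<close>, obtained from two applications of the
Cauchy--Schwarz inequality that pass through the sum of cubes.
\<close>

lemma sum_square_cube_le:
  fixes x :: "'i \<Rightarrow> real"
  assumes x: "\<And>i. i \<in> I \<Longrightarrow> 0 \<le> x i"
  shows "(\<Sum>i\<in>I. (x i)\<^sup>2) ^ 3 \<le> (\<Sum>i\<in>I. x i)\<^sup>2 * (\<Sum>i\<in>I. x i ^ 4)"
proof -
  define s1 s2 s3 s4 where "s1 = (\<Sum>i\<in>I. x i)" and "s2 = (\<Sum>i\<in>I. (x i)\<^sup>2)"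
    and "s3 = (\<Sum>i\<in>I. x i ^ 3)" and "s4 = (\<Sum>i\<in>I. x i ^ 4)"
  have nonneg: "s1 \<ge> 0" "s2 \<ge> 0" "s3 \<ge> 0" "s4 \<ge> 0"
    using x by (auto simp: s1_def s2_def s3_def s4_def intro!: sum_nonneg)
  have "(\<Sum>i\<in>I. sqrt (x i) * (sqrt (x i) * x i))\<^sup>2 \<le> (\<Sum>i\<in>I. (sqrt (x i))\<^sup>2) * (\<Sum>i\<in>I. (sqrt (x i) * x i)\<^sup>2)"
    by (rule Cauchy_Schwarz_ineq_sum)
  also have "(\<Sum>i\<in>I. sqrt (x i) * (sqrt (x i) * x i)) = s2"
    unfolding s2_def using x by (intro sum.cong) (auto simp: power2_eq_square simp flip: mult.assoc)
  also have "(\<Sum>i\<in>I. (sqrt (x i))\<^sup>2) = s1"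
    unfolding s1_def using x by (intro sum.cong) auto
  also have "(\<Sum>i\<in>I. (sqrt (x i) * x i)\<^sup>2) = s3"
    unfolding s3_def using x by (intro sum.cong) (auto simp: power_mult_distrib eval_nat_numeral)
  finally have 1: "s2\<^sup>2 \<le> s1 * s3" .
  have "(\<Sum>i\<in>I. x i * (x i)\<^sup>2)\<^sup>2 \<le> (\<Sum>i\<in>I. (x i)\<^sup>2) * (\<Sum>i\<in>I. ((x i)\<^sup>2)\<^sup>2)"
    by (rule Cauchy_Schwarz_ineq_sum)
  then have 2: "s3\<^sup>2 \<le> s2 * s4"
    by (simp add: s3_def s2_def s4_def eval_nat_numeral mult_ac)
  have "s2 * s2 ^ 3 = (s2\<^sup>2)\<^sup>2" by (simp add: eval_nat_numeral)
  also have "\<dots> \<le> (s1 * s3)\<^sup>2" using 1 by (intro power_mono) auto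
  also have "\<dots> = s1\<^sup>2 * s3\<^sup>2" by (simp add: power_mult_distrib)
  also have "\<dots> \<le> s1\<^sup>2 * (s2 * s4)" using 2 by (intro mult_left_mono) auto
  finally have "s2 * s2 ^ 3 \<le> s2 * (s1\<^sup>2 * s4)" by (simp add: mult_ac)
  then have "s2 ^ 3 \<le> s1\<^sup>2 * s4"
    using nonneg by (cases "s2 = 0") auto
  then show ?thesis by (simp add: s1_def s2_def s4_def)
qed

lemma multi_indices_subset_grid:
  assumes "k < N"
  shows "multi_indices n k \<subseteq> {..<n} \<rightarrow>\<^sub>E {..<N}"
proof
  fix \<alpha> assume \<alpha>: "\<alpha> \<in> multi_indices n k"
  then have "\<alpha> i < N" if "i < n" for i
    using multi_indices_le[OF \<alpha> that] assms by simp
  with \<alpha> show "\<alpha> \<in> {..<n} \<rightarrow>\<^sub>E {..<N}"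
    by (simp add: multi_indices_def PiE_iff)
qed

text \<open>
The square of the polynomial has as coefficient at \<open>\<gamma>\<close> a sum over the ways of writing \<open>\<gamma>\<close> as a sum
of two multi-indices of degree \<open>k\<close>.  The first summand is dominated by \<open>\<gamma>\<close>, so there are at
most \<open>\<Prod>i. (\<gamma> i + 1) \<le> 2 ^ (2 * k)\<close> ways.  Parseval's identity for the square and the
Cauchy--Schwarz inequality in each fibre give the bound.  The grid has to resolve
degree \<open>2 * k\<close>.
\<close>

lemma torus_fourth_moment_le:
  assumes N: "2 * k < N"
  shows "(\<Sum>g\<in>{..<n} \<rightarrow>\<^sub>E {..<N}. norm (hom_poly n k b (torus_point n N g)) ^ 4)
       \<le> real N ^ n * 4 ^ k * (\<Sum>\<beta>\<in>multi_indices n k. (norm (b \<beta>))\<^sup>2)\<^sup>2"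
proof -
  define I where "I = multi_indices n k \<times> multi_indices n k"
  define add where "add = (\<lambda>p. \<lambda>i\<in>{..<n}. fst p i + snd p i :: nat)"
  define fib where "fib = (\<lambda>\<gamma>. {p \<in> I. add p = \<gamma>})"
  define c where "c = (\<lambda>\<gamma>. \<Sum>p\<in>fib \<gamma>. b (fst p) * b (snd p))"
  have finI: "finite I" by (simp add: I_def finite_multi_indices)
  have add_in: "add p \<in> multi_indices n (2 * k)" if "p \<in> I" for p
  proof -
    have "(\<Sum>i<n. add p i) = (\<Sum>i<n. fst p i) + (\<Sum>i<n. snd p i)"
      by (simp add: add_def sum.distrib)
    also have "\<dots> = 2 * k"
      using that by (simp add: I_def multi_indices_def mem_Times_iff)
    finally show ?thesis
      by (simp add: multi_indices_def) (simp add: add_def)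
  qed
  have card_fib: "card (fib \<gamma>) \<le> 4 ^ k" if \<gamma>: "\<gamma> \<in> multi_indices n (2 * k)" for \<gamma>
  proof -
    have fib_ext: "fst p \<in> {..<n} \<rightarrow>\<^sub>E UNIV" "snd p \<in> {..<n} \<rightarrow>\<^sub>E UNIV" if "p \<in> fib \<gamma>" for p
      using that by (simp_all add: fib_def I_def multi_indices_def mem_Times_iff)
    have add_eq: "fst p i + snd p i = \<gamma> i" if "p \<in> fib \<gamma>" "i < n" for p i
    proof -
      have "\<gamma> = add p" using that by (simp add: fib_def)
      then show ?thesis using that by (simp add: add_def)
    qed
    have "inj_on fst (fib \<gamma>)"
    proof (rule inj_onI)
      fix p p' assume p: "p \<in> fib \<gamma>" and p': "p' \<in> fib \<gamma>" and eq: "fst p = fst p'"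
      have "snd p \<in> {..<n} \<rightarrow>\<^sub>E UNIV" "snd p' \<in> {..<n} \<rightarrow>\<^sub>E UNIV"
        using p p' fib_ext by blast+
      moreover have "snd p i = snd p' i" if "i < n" for i
        using add_eq[OF p that] add_eq[OF p' that] eq by simp
      ultimately have "snd p = snd p'" using PiE_ext by (metis lessThan_iff)
      then show "p = p'" using eq by (simp add: prod_eq_iff)
    qed
    moreover have "fst ` fib \<gamma> \<subseteq> (\<Pi>\<^sub>E i\<in>{..<n}. {..\<gamma> i})"
    proof
      fix \<alpha> assume "\<alpha> \<in> fst ` fib \<gamma>"
      then obtain p where p: "p \<in> fib \<gamma>" "\<alpha> = fst p" by auto
      then have "\<alpha> \<in> {..<n} \<rightarrow>\<^sub>E UNIV"
        using fib_ext by blast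
      moreover have "\<alpha> i \<le> \<gamma> i" if "i < n" for i
        using add_eq[OF p(1) that] p(2) by simp
      ultimately show "\<alpha> \<in> (\<Pi>\<^sub>E i\<in>{..<n}. {..\<gamma> i})" by (auto simp: PiE_iff)
    qed
    ultimately have "card (fib \<gamma>) \<le> card (\<Pi>\<^sub>E i\<in>{..<n}. {..\<gamma> i})"
      by (metis card_image card_mono finite_PiE finite_atMost finite_lessThan)
    also have "\<dots> = (\<Prod>i<n. Suc (\<gamma> i))" by (simp add: card_PiE)
    also have "\<dots> \<le> (\<Prod>i<n. 2 ^ \<gamma> i)"
      by (intro prod_mono) (auto simp: Suc_le_eq)
    also have "\<dots> = 2 ^ (2 * k)"
      using \<gamma> by (simp add: multi_indices_def flip: power_sum)
    finally show ?thesis by (simp add: power_mult)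
  qed
  have square: "(hom_poly n k b z)\<^sup>2 = (\<Sum>\<gamma>\<in>multi_indices n (2 * k). c \<gamma> * (\<Prod>i<n. z i ^ \<gamma> i))" for z
  proof -
    have "(hom_poly n k b z)\<^sup>2 = (\<Sum>p\<in>I. b (fst p) * b (snd p) * (\<Prod>i<n. z i ^ add p i))"
      by (simp add: hom_poly_def power2_eq_square sum_product I_def sum.cartesian_product
          add_def power_add prod.distrib case_prod_unfold mult_ac)
    also have "\<dots> = (\<Sum>\<gamma>\<in>multi_indices n (2 * k). \<Sum>p\<in>fib \<gamma>. b (fst p) * b (snd p) * (\<Prod>i<n. z i ^ add p i))"
      unfolding fib_def using add_in by (intro sum.group[symmetric]) (auto simp: finI finite_multi_indices)
    also have "\<dots> = (\<Sum>\<gamma>\<in>multi_indices n (2 * k). c \<gamma> * (\<Prod>i<n. z i ^ \<gamma> i))"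
      unfolding c_def sum_distrib_right by (intro sum.cong refl) (auto simp: fib_def)
    finally show ?thesis .
  qed
  have c_le: "(norm (c \<gamma>))\<^sup>2 \<le> 4 ^ k * (\<Sum>p\<in>fib \<gamma>. (norm (b (fst p)))\<^sup>2 * (norm (b (snd p)))\<^sup>2)"
    if \<gamma>: "\<gamma> \<in> multi_indices n (2 * k)" for \<gamma>
  proof -
    have "(norm (c \<gamma>))\<^sup>2 \<le> (\<Sum>p\<in>fib \<gamma>. 1 * (norm (b (fst p)) * norm (b (snd p))))\<^sup>2"
      unfolding c_def by (intro power_mono) (auto simp flip: norm_mult intro!: norm_sum)
    also have "\<dots> \<le> (\<Sum>p\<in>fib \<gamma>. 1\<^sup>2) * (\<Sum>p\<in>fib \<gamma>. (norm (b (fst p)) * norm (b (snd p)))\<^sup>2)"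
      by (rule Cauchy_Schwarz_ineq_sum)
    also have "\<dots> = real (card (fib \<gamma>)) * (\<Sum>p\<in>fib \<gamma>. (norm (b (fst p)))\<^sup>2 * (norm (b (snd p)))\<^sup>2)"
      by (simp add: power_mult_distrib)
    also have "\<dots> \<le> 4 ^ k * (\<Sum>p\<in>fib \<gamma>. (norm (b (fst p)))\<^sup>2 * (norm (b (snd p)))\<^sup>2)"
      using card_fib[OF \<gamma>, THEN of_nat_mono, where 'a = real]
      by (intro mult_right_mono sum_nonneg) auto
    finally show ?thesis .
  qed
  have "(\<Sum>g\<in>{..<n} \<rightarrow>\<^sub>E {..<N}. norm (hom_poly n k b (torus_point n N g)) ^ 4)
      = (\<Sum>g\<in>{..<n} \<rightarrow>\<^sub>E {..<N}. (norm ((hom_poly n k b (torus_point n N g))\<^sup>2))\<^sup>2)"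
    by (simp add: norm_power)
  also have "\<dots> = real N ^ n * (\<Sum>\<gamma>\<in>multi_indices n (2 * k). (norm (c \<gamma>))\<^sup>2)"
    unfolding square
    using N by (intro torus_parseval multi_indices_subset_grid) simp
  also have "\<dots> \<le> real N ^ n * (\<Sum>\<gamma>\<in>multi_indices n (2 * k).
        4 ^ k * (\<Sum>p\<in>fib \<gamma>. (norm (b (fst p)))\<^sup>2 * (norm (b (snd p)))\<^sup>2))"
    by (intro mult_left_mono sum_mono c_le) auto
  also have "\<dots> = real N ^ n * 4 ^ k * (\<Sum>p\<in>I. (norm (b (fst p)))\<^sup>2 * (norm (b (snd p)))\<^sup>2)"
    unfolding fib_def sum_distrib_left[symmetric] using add_in
    by (subst sum.group) (auto simp: finI finite_multi_indices)
  also have "\<dots> = real N ^ n * 4 ^ k * (\<Sum>\<beta>\<in>multi_indices n k. (norm (b \<beta>))\<^sup>2)\<^sup>2"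
    by (simp add: I_def power2_eq_square[of "sum _ _"] sum_product sum.cartesian_product case_prod_unfold)
  finally show ?thesis .
qed

text \<open>
A Khinchine-type inequality: for homogeneous polynomials the first and second moments on the torus
differ at most by a factor exponential in the degree.  Since the fourth moment is controlled by
the square of the second, Hoelder's inequality leaves no room for a small first moment.
\<close>

lemma l2_norm_le_torus_mean:
  assumes N: "2 * k < N"
  shows "real N ^ n * sqrt (\<Sum>\<beta>\<in>multi_indices n k. (norm (b \<beta>))\<^sup>2)
       \<le> 2 ^ k * (\<Sum>g\<in>{..<n} \<rightarrow>\<^sub>E {..<N}. norm (hom_poly n k b (torus_point n N g)))"
proof -
  define B where "B = sqrt (\<Sum>\<beta>\<in>multi_indices n k. (norm (b \<beta>))\<^sup>2)"
  define E1 where "E1 = (\<Sum>g\<in>{..<n} \<rightarrow>\<^sub>E {..<N}. norm (hom_poly n k b (torus_point n N g)))"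
  have B: "B \<ge> 0" "B\<^sup>2 = (\<Sum>\<beta>\<in>multi_indices n k. (norm (b \<beta>))\<^sup>2)"
    unfolding B_def by (simp_all add: sum_nonneg)
  have E1: "E1 \<ge> 0" unfolding E1_def by (rule sum_nonneg) simp
  have second_moment: "(\<Sum>g\<in>{..<n} \<rightarrow>\<^sub>E {..<N}. (norm (hom_poly n k b (torus_point n N g)))\<^sup>2) = real N ^ n * B\<^sup>2"
    unfolding hom_poly_def B
    using N by (intro torus_parseval multi_indices_subset_grid) simp
  have "(real N ^ n * B\<^sup>2) ^ 3 \<le> E1\<^sup>2 * (\<Sum>g\<in>{..<n} \<rightarrow>\<^sub>E {..<N}. norm (hom_poly n k b (torus_point n N g)) ^ 4)"
    unfolding second_moment[symmetric] E1_def by (rule sum_square_cube_le) auto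
  also have "\<dots> \<le> E1\<^sup>2 * (real N ^ n * 4 ^ k * (B\<^sup>2)\<^sup>2)"
    unfolding B using torus_fourth_moment_le[OF N] by (intro mult_left_mono) auto
  also have "4 ^ k = ((2::real) ^ k)\<^sup>2" by (simp add: power2_eq_square flip: power_mult_distrib)
  finally have "(real N ^ n * B ^ 4) * (real N ^ n * B)\<^sup>2 \<le> (real N ^ n * B ^ 4) * (2 ^ k * E1)\<^sup>2"
    by (simp add: power_mult_distrib eval_nat_numeral mult_ac)
  then have "B = 0 \<or> (real N ^ n * B)\<^sup>2 \<le> (2 ^ k * E1)\<^sup>2"
    using N B by (auto simp: mult_le_cancel_left zero_less_mult_iff)
  then show ?thesis
    using E1 unfolding B_def[symmetric] E1_def[symmetric] by (auto dest: power2_le_imp_le)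
qed

section \<open>The supremum norm and Euler derivatives\<close>

lemma hom_poly_cong:
  assumes "\<And>i. i < n \<Longrightarrow> z i = w i"
  shows "hom_poly n m a z = hom_poly n m a w"
  using assms by (simp add: hom_poly_def)

lemma hom_poly_scale:
  fixes a :: "(nat \<Rightarrow> nat) \<Rightarrow> 'k::real_normed_field"
  shows "hom_poly n m a (\<lambda>i. c * z i) = c ^ m * hom_poly n m a z"
proof -
  have "(\<Prod>i<n. c ^ \<alpha> i) = c ^ m" if "\<alpha> \<in> multi_indices n m" for \<alpha>
    using that by (simp add: multi_indices_def flip: power_sum)
  then show ?thesis
    by (simp add: hom_poly_def sum_distrib_left power_mult_distrib prod.distrib mult_ac)
qed

lemma norm_hom_poly_le_sup_norm:
  fixes a :: "(nat \<Rightarrow> nat) \<Rightarrow> 'k::real_normed_field"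
  assumes z: "z \<in> {..<n} \<rightarrow>\<^sub>E cball 0 1"
  shows "norm (hom_poly n m a z) \<le> sup_norm n (hom_poly n m a)"
  unfolding sup_norm_def
proof (rule cSUP_upper[OF z])
  have "norm (hom_poly n m a z) \<le> (\<Sum>\<alpha>\<in>multi_indices n m. norm (a \<alpha>))"
    if "z \<in> {..<n} \<rightarrow>\<^sub>E cball 0 1" for z
  proof -
    have "norm (a \<alpha> * (\<Prod>i<n. z i ^ \<alpha> i)) \<le> norm (a \<alpha>)" for \<alpha>
    proof -
      have "norm (\<Prod>i<n. z i ^ \<alpha> i) = (\<Prod>i<n. norm (z i) ^ \<alpha> i)"
        by (simp add: norm_power flip: prod_norm)
      also have "\<dots> \<le> 1"
        using that by (intro prod_le_1) (auto simp: PiE_iff intro: power_le_one)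
      finally show ?thesis
        by (simp add: norm_mult mult_left_le)
    qed
    then show ?thesis
      unfolding hom_poly_def by (intro sum_norm_le)
  qed
  then show "bdd_above ((\<lambda>z. norm (hom_poly n m a z)) ` ({..<n} \<rightarrow>\<^sub>E cball 0 1))"
    by (intro bdd_aboveI2)
qed

text \<open>
The homogeneous form of the preceding bound, for polydiscs (or cubes) of any radius.
\<close>

lemma norm_hom_poly_le_power_sup_norm:
  fixes a :: "(nat \<Rightarrow> nat) \<Rightarrow> 'k::real_normed_field"
  assumes R: "R > 0" and z: "\<And>i. i < n \<Longrightarrow> norm (z i) \<le> R"
  shows "norm (hom_poly n m a z) \<le> R ^ m * sup_norm n (hom_poly n m a)"
proof -
  define w where "w = (\<lambda>i\<in>{..<n}. z i / of_real R)"
  have "w \<in> {..<n} \<rightarrow>\<^sub>E cball 0 1"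
    using R z by (auto simp: w_def PiE_iff norm_divide divide_simps)
  then have "norm (hom_poly n m a w) \<le> sup_norm n (hom_poly n m a)"
    by (rule norm_hom_poly_le_sup_norm)
  moreover have "hom_poly n m a z = hom_poly n m a (\<lambda>i. of_real R * w i)"
    using R by (intro hom_poly_cong) (simp add: w_def)
  ultimately show ?thesis
    using R by (simp add: hom_poly_scale norm_mult norm_power mult_left_mono)
qed

text \<open>
Multipliers \<open>w l\<close> that turn each \<open>w l * D l\<close> into its modulus make the sum the derivative at \<open>0\<close> of \<open>P\<close>
along \<open>t \<mapsto> (z l * (1 + t * w l))\<^sub>l\<close>.  For \<open>\<bar>t\<bar> = 1\<close> that curve lies in the polydisc of radius \<open>2\<close>, and
Cauchy's estimate applies.
\<close>

lemma sum_euler_derivatives_le: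
  fixes a :: "(nat \<Rightarrow> nat) \<Rightarrow> complex"
  assumes z: "\<And>i. i < n \<Longrightarrow> norm (z i) \<le> 1"
  shows "(\<Sum>l<n. norm (hom_poly n m (\<lambda>\<alpha>. of_nat (\<alpha> l) * a \<alpha>) z)) \<le> 2 ^ m * sup_norm n (hom_poly n m a)"
proof -
  define D where "D = (\<lambda>l. hom_poly n m (\<lambda>\<alpha>. of_nat (\<alpha> l) * a \<alpha>) z)"
  define w where "w = (\<lambda>l. if D l = 0 then 0 else cnj (D l) / of_real (norm (D l)))"
  define f where "f = (\<lambda>t. hom_poly n m a (\<lambda>i. z i * (1 + t * w i)))"
  have norm_w: "norm (w l) \<le> 1" for l
    by (simp add: w_def norm_divide)
  have w_D: "w l * D l = of_real (norm (D l))" for l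
    by (simp add: w_def complex_norm_square[symmetric] power2_eq_square mult.commute[of "cnj _"])
  have hol: "f holomorphic_on A" for A
    unfolding f_def hom_poly_def by (intro holomorphic_intros)
  have monomial_deriv:
    "((\<lambda>t. \<Prod>i<n. (z i * (1 + t * w i)) ^ \<alpha> i) has_field_derivative
        (\<Sum>l<n. of_nat (\<alpha> l) * w l * (\<Prod>i<n. z i ^ \<alpha> i))) (at 0)" for \<alpha>
  proof -
    have "((\<lambda>t. (z l * (1 + t * w l)) ^ \<alpha> l) has_field_derivative of_nat (\<alpha> l) * w l * z l ^ \<alpha> l) (at 0)" for l
      unfolding power_mult_distrib by (auto intro!: derivative_eq_intros)
    then have "((\<lambda>t. \<Prod>l<n. (z l * (1 + t * w l)) ^ \<alpha> l) has_field_derivative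
        (\<Sum>l<n. of_nat (\<alpha> l) * w l * z l ^ \<alpha> l * (\<Prod>i\<in>{..<n} - {l}. (z i * (1 + 0 * w i)) ^ \<alpha> i))) (at 0)"
      by (rule has_field_derivative_prod)
    also have "(\<Sum>l<n. of_nat (\<alpha> l) * w l * z l ^ \<alpha> l * (\<Prod>i\<in>{..<n} - {l}. (z i * (1 + 0 * w i)) ^ \<alpha> i))
        = (\<Sum>l<n. of_nat (\<alpha> l) * w l * (\<Prod>i<n. z i ^ \<alpha> i))"
      by (intro sum.cong refl) (simp add: prod.remove[of "{..<n}"] mult.assoc)
    finally show ?thesis .
  qed
  have "(f has_field_derivative (\<Sum>\<alpha>\<in>multi_indices n m. a \<alpha> * (\<Sum>l<n. of_nat (\<alpha> l) * w l * (\<Prod>i<n. z i ^ \<alpha> i)))) (at 0)"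
    unfolding f_def hom_poly_def by (intro DERIV_sum DERIV_cmult monomial_deriv)
  also have "(\<Sum>\<alpha>\<in>multi_indices n m. a \<alpha> * (\<Sum>l<n. of_nat (\<alpha> l) * w l * (\<Prod>i<n. z i ^ \<alpha> i))) = (\<Sum>l<n. w l * D l)"
    unfolding D_def hom_poly_def sum_distrib_left
    by (subst sum.swap) (simp add: mult_ac)
  also have "\<dots> = of_real (\<Sum>l<n. norm (D l))"
    by (simp add: w_D)
  finally have deriv: "deriv f 0 = of_real (\<Sum>l<n. norm (D l))"
    by (rule DERIV_imp_deriv)
  have "norm ((deriv ^^ 1) f 0) \<le> fact 1 * (2 ^ m * sup_norm n (hom_poly n m a)) / 1 ^ 1"
  proof (rule Cauchy_inequality)
    fix t :: complex assume "norm (0 - t) = 1"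
    then have "norm (z i * (1 + t * w i)) \<le> 1 * (1 + 1 * 1)" if "i < n" for i
      unfolding norm_mult using z[OF that] norm_w[of i]
      by (intro mult_mono norm_triangle_mono) (auto simp: norm_mult)
    then show "norm (f t) \<le> 2 ^ m * sup_norm n (hom_poly n m a)"
      unfolding f_def by (intro norm_hom_poly_le_power_sup_norm) auto
  qed (use hol holomorphic_on_imp_continuous_on in auto)
  then have "norm (of_real (\<Sum>l<n. norm (D l)) :: complex) \<le> 2 ^ m * sup_norm n (hom_poly n m a)"
    by (simp add: deriv)
  then show ?thesis
    unfolding norm_of_real D_def by linarith
qed

text \<open>
The pointwise bound on the Euler derivatives is averaged over the grid, and each mean is bounded
below by the \<open>\<ell>\<^sub>2\<close> norm of the coefficients.
\<close>

lemma sum_l2_norms_euler_derivatives_le: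
  fixes a :: "(nat \<Rightarrow> nat) \<Rightarrow> complex"
  shows "(\<Sum>l<n. sqrt (\<Sum>\<alpha>\<in>multi_indices n m. (norm (of_nat (\<alpha> l) * a \<alpha>))\<^sup>2))
       \<le> 4 ^ m * sup_norm n (hom_poly n m a)"
proof -
  \<comment> \<open>A grid fine enough for the square of a polynomial of degree \<open>m\<close>.\<close>
  define N where "N = 2 * m + 1"
  define D where "D = (\<lambda>l z. hom_poly n m (\<lambda>\<alpha>. of_nat (\<alpha> l) * a \<alpha>) z)"
  define G where "G = ({..<n} \<rightarrow>\<^sub>E {..<N})"
  have "real N ^ n * (\<Sum>l<n. sqrt (\<Sum>\<alpha>\<in>multi_indices n m. (norm (of_nat (\<alpha> l) * a \<alpha>))\<^sup>2))
      \<le> (\<Sum>l<n. 2 ^ m * (\<Sum>g\<in>G. norm (D l (torus_point n N g))))"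
    unfolding sum_distrib_left D_def G_def N_def
    by (intro sum_mono, unfold sum_distrib_left[symmetric]) (intro l2_norm_le_torus_mean, simp)
  also have "\<dots> = 2 ^ m * (\<Sum>g\<in>G. \<Sum>l<n. norm (D l (torus_point n N g)))"
    by (subst sum.swap) (simp add: sum_distrib_left)
  also have "\<dots> \<le> 2 ^ m * (\<Sum>g\<in>G. 2 ^ m * sup_norm n (hom_poly n m a))"
    unfolding D_def
    by (intro mult_left_mono sum_mono sum_euler_derivatives_le) (auto simp: norm_torus_point)
  also have "\<dots> = real N ^ n * (4 ^ m * sup_norm n (hom_poly n m a))"
    by (simp add: G_def card_PiE flip: power_mult_distrib)
  finally show ?thesis
    by (simp add: N_def)
qed

section \<open>The upper bounds\<close>

text \<open>
With \<open>S\<close> the sum of the \<open>\<ell>\<^sub>2\<close> norms of the Euler derivatives, the coefficients of \<open>P / S\<close> satisfy the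
hypotheses of the Blei-type inequality because \<open>\<alpha> l \<le> (\<alpha> l)\<^sup>2\<close> for natural numbers.
\<close>

lemma coeff_norm_le_complex:
  fixes a :: "(nat \<Rightarrow> nat) \<Rightarrow> complex"
  assumes m: "m \<ge> 1" and n: "n \<ge> 1" and r: "r \<in> {1..2 * real m / (real m + 1)}"
  shows "coeff_norm n m r a
       \<le> 4 ^ m * real n powr (real m / r - (real m + 1) / 2) * sup_norm n (hom_poly n m a)"
proof -
  define \<rho> where "\<rho> = 2 * real m / (real m + 1)"
  define A where "A = (\<lambda>l. sqrt (\<Sum>\<alpha>\<in>multi_indices n m. (norm (of_nat (\<alpha> l) * a \<alpha>))\<^sup>2))"
  define S where "S = (\<Sum>l<n. A l)"
  have r': "0 < r" "r \<le> \<rho>" using r by (auto simp: \<rho>_def)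
  have A_nonneg: "A l \<ge> 0" for l by (simp add: A_def sum_nonneg)
  have S_nonneg: "S \<ge> 0" by (simp add: S_def sum_nonneg A_nonneg)
  have S_le: "S \<le> 4 ^ m * sup_norm n (hom_poly n m a)"
    unfolding S_def A_def by (rule sum_l2_norms_euler_derivatives_le)
  have "(\<Sum>\<alpha>\<in>multi_indices n m. norm (a \<alpha>) powr r) powr (1 / r)
      \<le> real n powr (real m / r - (real m + 1) / 2) * S"
  proof (cases "S = 0")
    case True
    have "a \<alpha> = 0" if \<alpha>: "\<alpha> \<in> multi_indices n m" for \<alpha>
    proof -
      obtain l where l: "l < n" "\<alpha> l \<noteq> 0" using \<alpha> m by (force simp: multi_indices_def)
      have "A l = 0" using True l A_nonneg by (simp add: S_def sum_nonneg_eq_0_iff)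
      then have "of_nat (\<alpha> l) * a \<alpha> = 0"
        using \<alpha> by (simp add: A_def sum_nonneg_eq_0_iff finite_multi_indices)
      then show ?thesis using l by simp
    qed
    then show ?thesis using True by simp
  next
    case False
    with S_nonneg have S: "S > 0" by simp
    have "(\<Sum>\<alpha>\<in>multi_indices n m. (norm (a \<alpha>) / S) powr \<rho>) \<le> 1"
      unfolding \<rho>_def
    proof (rule sum_powr_coefficients_le_one[where A = "\<lambda>l. A l / S"])
      fix l
      have "(\<Sum>\<alpha>\<in>multi_indices n m. real (\<alpha> l) * (norm (a \<alpha>) / S)\<^sup>2)
          \<le> (\<Sum>\<alpha>\<in>multi_indices n m. (norm (of_nat (\<alpha> l) * a \<alpha>))\<^sup>2 / S\<^sup>2)"
      proof (rule sum_mono)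
        fix \<alpha>
        have "real (\<alpha> l) \<le> (real (\<alpha> l))\<^sup>2"
          by (cases "\<alpha> l") (auto simp: power2_eq_square)
        then show "real (\<alpha> l) * (norm (a \<alpha>) / S)\<^sup>2 \<le> (norm (of_nat (\<alpha> l) * a \<alpha>))\<^sup>2 / S\<^sup>2"
          by (simp add: norm_mult power_mult_distrib power_divide divide_right_mono mult_right_mono)
      qed
      also have "\<dots> = (A l / S)\<^sup>2"
        by (simp add: A_def power_divide sum_nonneg flip: sum_divide_distrib)
      finally show "(\<Sum>\<alpha>\<in>multi_indices n m. real (\<alpha> l) * (norm (a \<alpha>) / S)\<^sup>2) \<le> (A l / S)\<^sup>2" .
    next
      show "(\<Sum>l<n. A l / S) \<le> 1"
        using S by (simp add: S_def flip: sum_divide_distrib)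
    qed (use m S A_nonneg in auto)
    then have "(\<Sum>\<alpha>\<in>multi_indices n m. (norm (a \<alpha>) / S) powr r) powr (1 / r)
        \<le> (real n ^ m) powr (1 / r - 1 / \<rho>)"
      using S r' n card_multi_indices_le[of n m, THEN of_nat_mono, where 'a = real]
      by (intro lr_norm_le_of_lrho_norm_le_one) (auto simp: finite_multi_indices)
    also have "\<dots> = real n powr (real m / r - (real m + 1) / 2)"
      using n m by (simp add: \<rho>_def powr_powr right_diff_distrib flip: powr_realpow)
    finally have "(\<Sum>\<alpha>\<in>multi_indices n m. norm (a \<alpha>) powr r / S powr r) powr (1 / r)
        \<le> real n powr (real m / r - (real m + 1) / 2)"
      using S by (simp add: powr_divide)
    moreover have "(\<Sum>\<alpha>\<in>multi_indices n m. norm (a \<alpha>) powr r / S powr r) powr (1 / r)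
        = (\<Sum>\<alpha>\<in>multi_indices n m. norm (a \<alpha>) powr r) powr (1 / r) / S"
      using S r' by (simp add: powr_divide sum_nonneg powr_powr flip: sum_divide_distrib)
    ultimately show ?thesis
      using S by (simp add: pos_divide_le_eq)
  qed
  also have "\<dots> \<le> real n powr (real m / r - (real m + 1) / 2) * (4 ^ m * sup_norm n (hom_poly n m a))"
    using S_le by (intro mult_left_mono) auto
  finally show ?thesis by (simp add: coeff_norm_def mult_ac)
qed

text \<open>
For \<open>z = x + i y\<close> the polynomial \<open>f(u) = P(x u + y (1 + u\<^sup>2)/2)\<close> of one complex variable links the polydisc
with the cube.  On the unit circle \<open>(1 + u\<^sup>2)/2 = u * Re u\<close>, so \<open>\<bar>f(u)\<bar> = \<bar>P(x + y Re u)\<bar>\<close> is a value at a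
real point.  At \<open>v = - i (sqrt 2 - 1)\<close>, a root of \<open>(1 + v\<^sup>2)/2 = i v\<close>, one has \<open>f(v) = v ^ m * P(z)\<close>.
The maximum principle compares the two.
\<close>

lemma sup_norm_complexification_le:
  fixes a :: "(nat \<Rightarrow> nat) \<Rightarrow> real"
  shows "sup_norm n (hom_poly n m (\<lambda>\<alpha>. complex_of_real (a \<alpha>)))
       \<le> (2 * (1 + sqrt 2)) ^ m * sup_norm n (hom_poly n m a)"
  unfolding sup_norm_def[of n "hom_poly n m (\<lambda>\<alpha>. complex_of_real (a \<alpha>))"]
proof (rule cSUP_least)
  show "({..<n} \<rightarrow>\<^sub>E cball 0 1 :: (nat \<Rightarrow> complex) set) \<noteq> {}"
    by (auto simp: PiE_eq_empty_iff)
next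
  fix z :: "nat \<Rightarrow> complex" assume z: "z \<in> {..<n} \<rightarrow>\<^sub>E cball 0 1"
  define P where "P = hom_poly n m (\<lambda>\<alpha>. complex_of_real (a \<alpha>))"
  define f where "f = (\<lambda>u. P (\<lambda>i. of_real (Re (z i)) * u + of_real (Im (z i)) * ((1 + u\<^sup>2) / 2)))"
  have P_real: "P (\<lambda>i. of_real (x i)) = of_real (hom_poly n m a x)" for x
    by (simp add: P_def hom_poly_def)
  have Re_Im_le: "\<bar>Re (z i)\<bar> \<le> 1" "\<bar>Im (z i)\<bar> \<le> 1" if "i < n" for i
    using z that abs_Re_le_cmod[of "z i"] abs_Im_le_cmod[of "z i"] by (force simp: PiE_iff)+
  have boundary: "norm (f u) \<le> 2 ^ m * sup_norm n (hom_poly n m a)" if u: "norm u = 1" for u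
  proof -
    have "u * cnj u = 1" using u by (simp add: complex_norm_square[symmetric])
    then have half_sum: "(1 + u\<^sup>2) / 2 = u * of_real (Re u)"
      by (simp add: complex_add_cnj[symmetric, THEN arg_cong[where f = "\<lambda>x. x / 2"]]
          power2_eq_square algebra_simps complex_eq_iff)
    then have "f u = P (\<lambda>i. u * of_real (Re (z i) + Im (z i) * Re u))"
      unfolding f_def half_sum by (simp add: algebra_simps)
    also have "\<dots> = u ^ m * of_real (hom_poly n m a (\<lambda>i. Re (z i) + Im (z i) * Re u))"
      unfolding P_real[symmetric] unfolding P_def by (rule hom_poly_scale)
    finally have "norm (f u) = norm (hom_poly n m a (\<lambda>i. Re (z i) + Im (z i) * Re u))"
      using u by (simp add: norm_mult norm_power)
    also have "\<dots> \<le> 2 ^ m * sup_norm n (hom_poly n m a)"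
    proof (rule norm_hom_poly_le_power_sup_norm)
      fix i assume "i < n"
      have "\<bar>Im (z i) * Re u\<bar> \<le> 1 * 1"
        unfolding abs_mult using Re_Im_le(2)[OF \<open>i < n\<close>] abs_Re_le_cmod[of u] u
        by (intro mult_mono) auto
      then show "norm (Re (z i) + Im (z i) * Re u) \<le> 2"
        using Re_Im_le(1)[OF \<open>i < n\<close>] by simp
    qed simp
    finally show ?thesis .
  qed
  define v where "v = - \<i> * of_real (sqrt 2 - 1)"
  have v_sq: "(1 + v\<^sup>2) / 2 = v * \<i>"
    by (simp add: v_def power2_eq_square algebra_simps complex_eq_iff diff_divide_distrib)
  have norm_v: "norm v = sqrt 2 - 1"
    unfolding v_def norm_mult norm_of_real by simp
  have "norm (f v) \<le> 2 ^ m * sup_norm n (hom_poly n m a)"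
  proof (rule maximum_modulus_frontier[of f "cball 0 1"])
    show "f holomorphic_on interior (cball 0 1)" "continuous_on (closure (cball 0 1)) f"
      unfolding f_def P_def hom_poly_def by (auto intro!: holomorphic_intros continuous_intros)
    show "v \<in> cball 0 1" using norm_v sqrt2_less_2 by simp
  qed (use boundary in auto)
  also have "f v = P (\<lambda>i. v * z i)"
  proof -
    have "of_real (Re (z i)) * v + of_real (Im (z i)) * (v * \<i>) = v * z i" for i
      by (subst (3) complex_eq) (simp add: algebra_simps)
    then show ?thesis by (simp only: f_def v_sq)
  qed
  also have "\<dots> = v ^ m * P z"
    unfolding P_def by (rule hom_poly_scale)
  finally have *: "(sqrt 2 - 1) ^ m * norm (P z) \<le> 2 ^ m * sup_norm n (hom_poly n m a)"
    by (simp add: norm_mult norm_power norm_v)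
  \<comment> \<open>The number \<open>1 + sqrt 2\<close> is the inverse of \<open>\<bar>v\<bar> = sqrt 2 - 1\<close>.\<close>
  have "norm (P z) = ((1 + sqrt 2) * (sqrt 2 - 1)) ^ m * norm (P z)"
    by (simp add: algebra_simps)
  also have "\<dots> = (1 + sqrt 2) ^ m * ((sqrt 2 - 1) ^ m * norm (P z))"
    by (simp add: power_mult_distrib)
  also have "\<dots> \<le> (1 + sqrt 2) ^ m * (2 ^ m * sup_norm n (hom_poly n m a))"
    by (intro mult_left_mono *) auto
  also have "\<dots> = (2 * (1 + sqrt 2)) ^ m * sup_norm n (hom_poly n m a)"
    unfolding power_mult_distrib by (simp add: mult_ac)
  finally show "norm (hom_poly n m (\<lambda>\<alpha>. complex_of_real (a \<alpha>)) z)
      \<le> (2 * (1 + sqrt 2)) ^ m * sup_norm n (hom_poly n m a)"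
    by (simp add: P_def)
qed

lemma coeff_norm_le_real:
  fixes a :: "(nat \<Rightarrow> nat) \<Rightarrow> real"
  assumes "m \<ge> 1" "n \<ge> 1" "r \<in> {1..2 * real m / (real m + 1)}"
  shows "coeff_norm n m r a
       \<le> (8 * (1 + sqrt 2)) ^ m * real n powr (real m / r - (real m + 1) / 2) * sup_norm n (hom_poly n m a)"
proof -
  define e where "e = real m / r - (real m + 1) / 2"
  have "coeff_norm n m r a = coeff_norm n m r (\<lambda>\<alpha>. complex_of_real (a \<alpha>))"
    by (simp add: coeff_norm_def)
  also have "\<dots> \<le> 4 ^ m * real n powr e * sup_norm n (hom_poly n m (\<lambda>\<alpha>. complex_of_real (a \<alpha>)))"
    unfolding e_def by (rule coeff_norm_le_complex) fact+
  also have "\<dots> \<le> 4 ^ m * real n powr e * ((2 * (1 + sqrt 2)) ^ m * sup_norm n (hom_poly n m a))"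
    by (intro mult_left_mono sup_norm_complexification_le) auto
  also have "\<dots> = (4 * (2 * (1 + sqrt 2))) ^ m * real n powr e * sup_norm n (hom_poly n m a)"
    unfolding power_mult_distrib by (simp add: mult_ac)
  finally show ?thesis by (simp add: e_def mult.assoc)
qed

section \<open>The Sylvester matrix and iterated bilinear forms\<close>

text \<open>
The entries of Sylvester's Hadamard matrix of order \<open>2 ^ k\<close>, which is built by the block scheme
\<open>((H, H), (H, - H))\<close>.
\<close>

fun sylvester :: "nat \<Rightarrow> nat \<Rightarrow> nat \<Rightarrow> real" where
  "sylvester 0 i j = 1"
| "sylvester (Suc k) i j =
     (if 2 ^ k \<le> i \<and> 2 ^ k \<le> j then - 1 else 1) * sylvester k (i mod 2 ^ k) (j mod 2 ^ k)"

lemma abs_sylvester: "\<bar>sylvester k i j\<bar> = 1"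
  by (induction k i j rule: sylvester.induct) (simp_all add: abs_mult)

lemma sum_lessThan_add:
  fixes f :: "nat \<Rightarrow> 'a::comm_monoid_add"
  shows "(\<Sum>i<m + n. f i) = (\<Sum>i<m. f i) + (\<Sum>i<n. f (m + i))"
  by (induction n) (simp_all add: add.assoc)

lemma parallelogram_law:
  fixes u v :: "'a::real_inner"
  shows "(norm (u + v))\<^sup>2 + (norm (u - v))\<^sup>2 = 2 * (norm u)\<^sup>2 + 2 * (norm v)\<^sup>2"
  by (simp add: power2_norm_eq_inner inner_simps inner_commute)

text \<open>
The block scheme maps \<open>(u, v)\<close> to \<open>(u + v, u - v)\<close>, so each doubling of the order contributes a
factor \<open>2\<close> by the parallelogram law.
\<close>

lemma sylvester_isometry:
  fixes x :: "nat \<Rightarrow> 'a::real_inner"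
  shows "(\<Sum>j<2 ^ k. (norm (\<Sum>i<2 ^ k. sylvester k i j *\<^sub>R x i))\<^sup>2) = 2 ^ k * (\<Sum>i<2 ^ k. (norm (x i))\<^sup>2)"
proof (induction k arbitrary: x)
  case 0
  then show ?case by (simp add: lessThan_Suc)
next
  case (Suc k)
  define u where "u = (\<lambda>j. \<Sum>i<2 ^ k. sylvester k i j *\<^sub>R x i)"
  define v where "v = (\<lambda>j. \<Sum>i<2 ^ k. sylvester k i j *\<^sub>R x (2 ^ k + i))"
  have double: "(2::nat) ^ Suc k = 2 ^ k + 2 ^ k" by simp
  have lower: "(\<Sum>i<2 ^ Suc k. sylvester (Suc k) i j *\<^sub>R x i) = u j + v j" if "j < 2 ^ k" for j
    unfolding double sum_lessThan_add u_def v_def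
    using that by (intro arg_cong2[where f = "(+)"] sum.cong) auto
  have upper: "(\<Sum>i<2 ^ Suc k. sylvester (Suc k) i (2 ^ k + j) *\<^sub>R x i) = u j - v j" if "j < 2 ^ k" for j
    unfolding double sum_lessThan_add u_def v_def diff_conv_add_uminus sum_negf[symmetric]
    using that by (intro arg_cong2[where f = "(+)"] sum.cong) auto
  have "(\<Sum>j<2 ^ Suc k. (norm (\<Sum>i<2 ^ Suc k. sylvester (Suc k) i j *\<^sub>R x i))\<^sup>2)
      = (\<Sum>j<2 ^ k. (norm (\<Sum>i<2 ^ Suc k. sylvester (Suc k) i j *\<^sub>R x i))\<^sup>2)
        + (\<Sum>j<2 ^ k. (norm (\<Sum>i<2 ^ Suc k. sylvester (Suc k) i (2 ^ k + j) *\<^sub>R x i))\<^sup>2)"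
    by (subst (1) double) (rule sum_lessThan_add)
  also have "\<dots> = (\<Sum>j<2 ^ k. (norm (u j + v j))\<^sup>2) + (\<Sum>j<2 ^ k. (norm (u j - v j))\<^sup>2)"
    by (intro arg_cong2[where f = "(+)"] sum.cong) (simp_all only: lower upper lessThan_iff)
  also have "\<dots> = 2 * (\<Sum>j<2 ^ k. (norm (u j))\<^sup>2) + 2 * (\<Sum>j<2 ^ k. (norm (v j))\<^sup>2)"
    by (simp add: parallelogram_law sum_distrib_left flip: sum.distrib)
  also have "\<dots> = 2 ^ Suc k * ((\<Sum>i<2 ^ k. (norm (x i))\<^sup>2) + (\<Sum>i<2 ^ k. (norm (x (2 ^ k + i)))\<^sup>2))"
    unfolding u_def v_def Suc by (simp add: algebra_simps)
  also have "\<dots> = 2 ^ Suc k * (\<Sum>i<2 ^ Suc k. (norm (x i))\<^sup>2)"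
    unfolding double sum_lessThan_add ..
  finally show ?case .
qed

text \<open>
Alternately apply the matrix \<open>h\<close> and multiply entrywise by the next block of variables.  The sum of
the entries of the last vector is the multilinear form with coefficients
\<open>\<Prod>k<m. h (t k) (t (Suc k))\<close>.
\<close>

primrec chain_vector :: "nat \<Rightarrow> (nat \<Rightarrow> nat \<Rightarrow> real) \<Rightarrow> (nat \<Rightarrow> nat \<Rightarrow> 'k::real_normed_field) \<Rightarrow> nat \<Rightarrow> nat \<Rightarrow> 'k" where
  "chain_vector n h x 0 j = x 0 j"
| "chain_vector n h x (Suc k) j = x (Suc k) j * (\<Sum>i<n. h i j *\<^sub>R chain_vector n h x k i)"

lemma sum_PiE_lessThan_Suc:
  "(\<Sum>t\<in>{..<Suc m} \<rightarrow>\<^sub>E S. F t) = (\<Sum>j\<in>S. \<Sum>t\<in>{..<m} \<rightarrow>\<^sub>E S. F (t(m := j)))"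
proof -
  have "inj_on (\<lambda>(j, t). t(m := j)) (S \<times> ({..<m} \<rightarrow>\<^sub>E S))"
    using inj_combinator[of m "{..<m}" "\<lambda>_. S"] by simp
  then show ?thesis
    by (simp add: lessThan_Suc PiE_insert_eq sum.reindex sum.cartesian_product case_prod_unfold)
qed

text \<open>
The weight \<open>g\<close> on the last index makes the induction work: splitting off that index turns the last matrix
entry into part of the weight of the shorter chain.
\<close>

lemma sum_chain_vector:
  "(\<Sum>j<n. g j * chain_vector n h x m j)
     = (\<Sum>t\<in>{..<Suc m} \<rightarrow>\<^sub>E {..<n}. of_real (\<Prod>k<m. h (t k) (t (Suc k))) * (\<Prod>k<Suc m. x k (t k)) * g (t m))"
proof (induction m arbitrary: g)
  case 0
  show ?case
    unfolding sum_PiE_lessThan_Suc by (simp add: mult.commute)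
next
  case (Suc m)
  have "(\<Sum>j<n. g j * chain_vector n h x (Suc m) j)
      = (\<Sum>j<n. \<Sum>i<n. (of_real (h i j) * x (Suc m) j * g j) * chain_vector n h x m i)"
    by (simp add: sum_distrib_left scaleR_conv_of_real mult_ac)
  also have "\<dots> = (\<Sum>j<n. \<Sum>t\<in>{..<Suc m} \<rightarrow>\<^sub>E {..<n}. of_real (\<Prod>k<m. h (t k) (t (Suc k)))
      * (\<Prod>k<Suc m. x k (t k)) * (of_real (h (t m) j) * x (Suc m) j * g j))"
    by (intro sum.cong refl Suc)
  also have "\<dots> = (\<Sum>t\<in>{..<Suc (Suc m)} \<rightarrow>\<^sub>E {..<n}. of_real (\<Prod>k<Suc m. h (t k) (t (Suc k)))
      * (\<Prod>k<Suc (Suc m). x k (t k)) * g (t (Suc m)))"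
    unfolding sum_PiE_lessThan_Suc[where m = "Suc m"]
    by (intro sum.cong refl) (simp add: mult_ac)
  finally show ?case .
qed

text \<open>
Multiplication by a block of the unit ball does not increase the Euclidean norm, and each application of
\<open>h\<close> increases it at most by \<open>sqrt n\<close>.  Two further factors \<open>sqrt n\<close> come from the Euclidean norm of the first
block and from the Cauchy--Schwarz inequality at the end.
\<close>

lemma norm_sum_chain_vector_le:
  fixes x :: "nat \<Rightarrow> nat \<Rightarrow> 'k::{real_normed_field, real_inner}"
  assumes h: "\<And>y :: nat \<Rightarrow> 'k. (\<Sum>j<n. (norm (\<Sum>i<n. h i j *\<^sub>R y i))\<^sup>2) \<le> real n * (\<Sum>i<n. (norm (y i))\<^sup>2)"
    and x: "\<And>k j. k \<le> m \<Longrightarrow> j < n \<Longrightarrow> norm (x k j) \<le> 1"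
  shows "norm (\<Sum>j<n. chain_vector n h x m j) \<le> sqrt (real n ^ (m + 2))"
proof -
  have l2: "(\<Sum>j<n. (norm (chain_vector n h x k j))\<^sup>2) \<le> real n ^ Suc k" if "k \<le> m" for k
    using that
  proof (induction k)
    case 0
    have "(\<Sum>j<n. (norm (x 0 j))\<^sup>2) \<le> (\<Sum>j<n. 1)"
      using x by (intro sum_mono power_le_one) auto
    then show ?case by simp
  next
    case (Suc k)
    have "(\<Sum>j<n. (norm (chain_vector n h x (Suc k) j))\<^sup>2) \<le> (\<Sum>j<n. (norm (\<Sum>i<n. h i j *\<^sub>R chain_vector n h x k i))\<^sup>2)"
      using x[OF Suc.prems] by (intro sum_mono power_mono) (auto simp: norm_mult intro!: mult_left_le_one_le)
    also have "\<dots> \<le> real n * (\<Sum>i<n. (norm (chain_vector n h x k i))\<^sup>2)" by (rule h)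
    also have "\<dots> \<le> real n * real n ^ Suc k" using Suc by (intro mult_left_mono) auto
    finally show ?case by simp
  qed
  have "norm (\<Sum>j<n. chain_vector n h x m j) \<le> (\<Sum>j<n. 1 * norm (chain_vector n h x m j))"
    using norm_sum by simp
  also have "\<dots> \<le> sqrt (real n * (\<Sum>j<n. (norm (chain_vector n h x m j))\<^sup>2))"
    using Cauchy_Schwarz_ineq_sum[of "\<lambda>_. 1" "\<lambda>j. norm (chain_vector n h x m j)" "{..<n}"]
    by (intro real_le_rsqrt) simp
  also have "\<dots> \<le> sqrt (real n * real n ^ Suc m)"
    using l2[of m] by (intro real_sqrt_le_mono mult_left_mono) auto
  finally show ?thesis by simp
qed

section \<open>Optimality of the exponent\<close>

text \<open>
The exponents of the monomial \<open>\<Prod>k<m. z (k * n + t k)\<close>, which takes one variable from each of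
\<open>m\<close> blocks of length \<open>n\<close>.
\<close>

definition block_index :: "nat \<Rightarrow> nat \<Rightarrow> (nat \<Rightarrow> nat) \<Rightarrow> nat \<Rightarrow> nat" where
  "block_index m n t = (\<lambda>j\<in>{..<m * n}. if t (j div n) = j mod n then 1 else 0)"

lemma prod_lessThan_mult:
  fixes f :: "nat \<Rightarrow> 'a::comm_monoid_mult"
  shows "(\<Prod>i<m * n. f i) = (\<Prod>k<m. \<Prod>j<n. f (k * n + j))"
proof (induction m)
  case (Suc m)
  have "(\<Prod>i<b + c. f i) = (\<Prod>i<b. f i) * (\<Prod>i<c. f (b + i))" for b c
    by (induction c) (simp_all add: mult.assoc)
  from this[of "m * n" n] show ?case using Suc by (simp add: add.commute)
qed simp

lemma sum_lessThan_mult: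
  fixes f :: "nat \<Rightarrow> 'a::comm_monoid_add"
  shows "(\<Sum>i<m * n. f i) = (\<Sum>k<m. \<Sum>j<n. f (k * n + j))"
proof (induction m)
  case (Suc m)
  then show ?case using sum_lessThan_add[of f "m * n" n] by (simp add: add.commute)
qed simp

lemma block_position:
  assumes "k < m" "j < (n::nat)"
  shows "k * n + j < m * n" "(k * n + j) div n = k" "(k * n + j) mod n = j"
proof -
  have "k * n + j < Suc k * n" using assms by simp
  also have "\<dots> \<le> m * n" using assms by (intro mult_right_mono) auto
  finally show "k * n + j < m * n" .
qed (use assms in auto)

lemma block_index_in:
  assumes t: "t \<in> {..<m} \<rightarrow>\<^sub>E {..<n}"
  shows "block_index m n t \<in> multi_indices (m * n) m"
proof -
  have "(\<Sum>i<m * n. block_index m n t i) = (\<Sum>k<m. \<Sum>j<n. if t k = j then 1 else 0)"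
    unfolding sum_lessThan_mult by (intro sum.cong refl) (simp add: block_index_def block_position)
  also have "\<dots> = (\<Sum>k<m. 1)"
    using t by (intro sum.cong refl) auto
  finally show ?thesis
    by (simp add: multi_indices_def) (simp add: block_index_def)
qed

lemma prod_block_index:
  fixes z :: "nat \<Rightarrow> 'a::comm_semiring_1"
  assumes t: "t \<in> {..<m} \<rightarrow>\<^sub>E {..<n}"
  shows "(\<Prod>i<m * n. z i ^ block_index m n t i) = (\<Prod>k<m. z (k * n + t k))"
proof -
  have "(\<Prod>i<m * n. z i ^ block_index m n t i) = (\<Prod>k<m. \<Prod>j<n. if j = t k then z (k * n + j) else 1)"
    unfolding prod_lessThan_mult by (intro prod.cong refl) (simp add: block_index_def block_position)
  also have "\<dots> = (\<Prod>k<m. z (k * n + t k))"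
    using t by (intro prod.cong refl) auto
  finally show ?thesis .
qed

lemma inj_on_block_index: "inj_on (block_index m n) ({..<m} \<rightarrow>\<^sub>E {..<n})"
proof (rule inj_onI)
  fix t s assume t: "t \<in> {..<m} \<rightarrow>\<^sub>E {..<n}" and s: "s \<in> {..<m} \<rightarrow>\<^sub>E {..<n}"
    and eq: "block_index m n t = block_index m n s"
  have "t k = s k" if k: "k < m" for k
  proof -
    have "t k < n" using t k by auto
    then have "block_index m n t (k * n + t k) = 1"
      using k by (simp add: block_index_def block_position)
    then have "block_index m n s (k * n + t k) = 1" using eq by simp
    then show ?thesis
      using k \<open>t k < n\<close> by (simp add: block_index_def block_position split: if_splits)
  qed
  then show "t = s" using t s PiE_ext by (metis lessThan_iff)
qed

text \<open>
The multilinear form of the Sylvester matrix, with its \<open>m\<close> vector arguments read as the blocks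
of one vector of length \<open>m * n\<close>.
\<close>

lemma ex_unimodular_polynomial_small_sup_norm:
  fixes n m p :: nat
  assumes m: "m \<ge> 1"
    and n_def: "n = 2 ^ p"
  shows "\<exists>a :: (nat \<Rightarrow> nat) \<Rightarrow> 'k::{real_normed_field, real_inner}.
    coeff_norm (m * n) m r a = (real n ^ m) powr (1 / r) \<and>
    sup_norm (m * n) (hom_poly (m * n) m a) \<le> sqrt (real n ^ (m + 1))"
proof -
  obtain m' where m': "m = Suc m'" using m by (cases m) auto
  define T where "T = ({..<m} \<rightarrow>\<^sub>E {..<n})"
  define b where "b = block_index m n"
  define s where "s = (\<lambda>t. \<Prod>k<m'. sylvester p (t k) (t (Suc k)))"
  define a :: "(nat \<Rightarrow> nat) \<Rightarrow> 'k" where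
    "a = (\<lambda>\<alpha>. if \<alpha> \<in> b ` T then of_real (s (the_inv_into T b \<alpha>)) else 0)"
  have inj: "inj_on b T" unfolding b_def T_def by (rule inj_on_block_index)
  have b_in: "b ` T \<subseteq> multi_indices (m * n) m"
    unfolding b_def T_def using block_index_in by blast
  have a_b: "a (b t) = of_real (s t)" if "t \<in> T" for t
    using that inj by (simp add: a_def the_inv_into_f_f)
  have sum_a: "(\<Sum>\<alpha>\<in>multi_indices (m * n) m. F \<alpha>) = (\<Sum>t\<in>T. F (b t))"
    if "\<And>\<alpha>. a \<alpha> = 0 \<Longrightarrow> F \<alpha> = 0" for F :: "(nat \<Rightarrow> nat) \<Rightarrow> 'c::comm_monoid_add"
  proof -
    have "(\<Sum>\<alpha>\<in>multi_indices (m * n) m. F \<alpha>) = (\<Sum>\<alpha>\<in>b ` T. F \<alpha>)"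
      using b_in that by (intro sum.mono_neutral_right) (auto simp: finite_multi_indices a_def)
    also have "\<dots> = (\<Sum>t\<in>T. F (b t))"
      unfolding sum.reindex[OF inj] by simp
    finally show ?thesis .
  qed
  have abs_s: "\<bar>s t\<bar> = 1" for t
    by (simp add: s_def abs_prod abs_sylvester)
  have "(\<Sum>\<alpha>\<in>multi_indices (m * n) m. norm (a \<alpha>) powr r) = (\<Sum>t\<in>T. norm (a (b t)) powr r)"
    by (rule sum_a) simp
  also have "\<dots> = real n ^ m"
    by (simp add: a_b abs_s T_def card_PiE)
  finally have norm_a: "coeff_norm (m * n) m r a = (real n ^ m) powr (1 / r)"
    by (simp add: coeff_norm_def)
  have "sup_norm (m * n) (hom_poly (m * n) m a) \<le> sqrt (real n ^ (m + 1))"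
    unfolding sup_norm_def
  proof (rule cSUP_least)
    show "({..<m * n} \<rightarrow>\<^sub>E cball 0 1 :: (nat \<Rightarrow> 'k) set) \<noteq> {}"
      by (auto simp: PiE_eq_empty_iff)
  next
    fix z :: "nat \<Rightarrow> 'k" assume z: "z \<in> {..<m * n} \<rightarrow>\<^sub>E cball 0 1"
    define x where "x = (\<lambda>k j. z (k * n + j))"
    have "hom_poly (m * n) m a z = (\<Sum>t\<in>T. a (b t) * (\<Prod>i<m * n. z i ^ b t i))"
      unfolding hom_poly_def by (rule sum_a) simp
    also have "\<dots> = (\<Sum>t\<in>T. of_real (s t) * (\<Prod>k<m. x k (t k)))"
      using a_b by (intro sum.cong refl) (simp add: b_def T_def prod_block_index x_def)
    also have "\<dots> = (\<Sum>j<n. 1 * chain_vector n (sylvester p) x m' j)"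
      unfolding sum_chain_vector by (simp add: T_def s_def m')
    finally have "norm (hom_poly (m * n) m a z) = norm (\<Sum>j<n. chain_vector n (sylvester p) x m' j)"
      by simp
    also have "\<dots> \<le> sqrt (real n ^ (m' + 2))"
    proof (rule norm_sum_chain_vector_le)
      show "(\<Sum>j<n. (norm (\<Sum>i<n. sylvester p i j *\<^sub>R y i))\<^sup>2) \<le> real n * (\<Sum>i<n. (norm (y i))\<^sup>2)" for y :: "nat \<Rightarrow> 'k"
        unfolding n_def sylvester_isometry by simp
      show "norm (x k j) \<le> 1" if "k \<le> m'" "j < n" for k j
        using z block_position(1)[of k m j n] that by (auto simp: x_def m' PiE_iff)
    qed
    finally show "norm (hom_poly (m * n) m a z) \<le> sqrt (real n ^ (m + 1))"
      by (simp add: m')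
  qed
  with norm_a show ?thesis by blast
qed

text \<open>
Tested on the polynomials above in \<open>m * 2 ^ p\<close> variables, the inequality keeps the geometric sequence
\<open>(2 powr \<delta>) ^ p\<close> bounded, where \<open>\<delta>\<close> is the gap between the critical exponent and \<open>q\<close>.
\<close>

lemma exponent_optimal:
  assumes m: "m \<ge> 1" and q: "q < real m / r - (real m + 1) / 2" and C: "C > 0"
    and bound: "\<And>n (a :: (nat \<Rightarrow> nat) \<Rightarrow> 'k::{real_normed_field, real_inner}). n \<ge> 1 \<Longrightarrow>
      coeff_norm n m r a \<le> C ^ m * real n powr q * sup_norm n (hom_poly n m a)"
  shows False
proof -
  define \<delta> where "\<delta> = real m / r - (real m + 1) / 2 - q"
  have \<delta>: "\<delta> > 0" using q by (simp add: \<delta>_def)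
  have "(2 powr \<delta>) ^ p \<le> C ^ m * real m powr q" for p
  proof -
    define n :: nat where "n = 2 ^ p"
    have n: "n \<ge> 1" by (simp add: n_def)
    obtain a :: "(nat \<Rightarrow> nat) \<Rightarrow> 'k" where
      norm_a: "coeff_norm (m * n) m r a = (real n ^ m) powr (1 / r)" and
      sup_a: "sup_norm (m * n) (hom_poly (m * n) m a) \<le> sqrt (real n ^ (m + 1))"
      using ex_unimodular_polynomial_small_sup_norm[OF m n_def] by blast
    have "real n powr (real m / r) = (real n ^ m) powr (1 / r)"
      using n by (simp add: powr_powr flip: powr_realpow)
    also have "\<dots> \<le> C ^ m * real (m * n) powr q * sup_norm (m * n) (hom_poly (m * n) m a)"
      using bound[of "m * n" a] m n by (simp add: norm_a)
    also have "\<dots> \<le> C ^ m * real (m * n) powr q * sqrt (real n ^ (m + 1))"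
      using sup_a C by (intro mult_left_mono) auto
    also have "sqrt (real n ^ (m + 1)) = real n powr ((real m + 1) / 2)"
    proof -
      have "real n ^ (m + 1) = real n powr (real m + 1)"
        using n powr_realpow[of "real n" "m + 1"] by (simp add: add.commute)
      then show ?thesis by (simp only: powr_half_sqrt[symmetric] powr_ge_zero powr_powr) simp
    qed
    also have "C ^ m * real (m * n) powr q * real n powr ((real m + 1) / 2)
        = C ^ m * real m powr q * real n powr (q + (real m + 1) / 2)"
      by (simp add: powr_mult powr_add)
    finally have "real n powr (real m / r) / real n powr (q + (real m + 1) / 2) \<le> C ^ m * real m powr q"
      using n by (simp add: pos_divide_le_eq)
    then have "real n powr \<delta> \<le> C ^ m * real m powr q"
      by (simp add: \<delta>_def algebra_simps flip: powr_diff)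
    then show ?thesis
      by (simp add: n_def powr_powr mult.commute flip: powr_realpow)
  qed
  moreover have "1 < 2 powr \<delta>" using \<delta> by simp
  then obtain p where "C ^ m * real m powr q < (2 powr \<delta>) ^ p"
    using real_arch_pow by blast
  ultimately show False by (meson not_less)
qed

theorem theorem1:
  "(\<exists>L>0. \<forall>m\<ge>1. \<forall>n\<ge>1. \<forall>r\<in>{1..2 * real m / (real m + 1)}.
         \<forall>a :: (nat \<Rightarrow> nat) \<Rightarrow> real.
           coeff_norm n m r a
             \<le> L ^ m * real n powr (real m / r - (real m + 1) / 2) * sup_norm n (hom_poly n m a))
   \<and> (\<forall>m\<ge>1. \<forall>r\<in>{1..2 * real m / (real m + 1)}. \<forall>q < real m / r - (real m + 1) / 2.
         \<not> (\<exists>C>0. \<forall>n\<ge>1. \<forall>a :: (nat \<Rightarrow> nat) \<Rightarrow> real.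
           coeff_norm n m r a \<le> C ^ m * real n powr q * sup_norm n (hom_poly n m a)))
   \<and> (\<exists>L>0. \<forall>m\<ge>1. \<forall>n\<ge>1. \<forall>r\<in>{1..2 * real m / (real m + 1)}.
         \<forall>a :: (nat \<Rightarrow> nat) \<Rightarrow> complex.
           coeff_norm n m r a
             \<le> L ^ m * real n powr (real m / r - (real m + 1) / 2) * sup_norm n (hom_poly n m a))
   \<and> (\<forall>m\<ge>1. \<forall>r\<in>{1..2 * real m / (real m + 1)}. \<forall>q < real m / r - (real m + 1) / 2.
         \<not> (\<exists>C>0. \<forall>n\<ge>1. \<forall>a :: (nat \<Rightarrow> nat) \<Rightarrow> complex.
           coeff_norm n m r a \<le> C ^ m * real n powr q * sup_norm n (hom_poly n m a)))"
proof (intro conjI)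
  show "\<exists>L>0. \<forall>m\<ge>1. \<forall>n\<ge>1. \<forall>r\<in>{1..2 * real m / (real m + 1)}.
      \<forall>a :: (nat \<Rightarrow> nat) \<Rightarrow> real. coeff_norm n m r a
        \<le> L ^ m * real n powr (real m / r - (real m + 1) / 2) * sup_norm n (hom_poly n m a)"
    by (intro exI[of _ "8 * (1 + sqrt 2)"] conjI allI impI ballI coeff_norm_le_real)
      (auto simp: add_pos_nonneg)
  show "\<exists>L>0. \<forall>m\<ge>1. \<forall>n\<ge>1. \<forall>r\<in>{1..2 * real m / (real m + 1)}.
      \<forall>a :: (nat \<Rightarrow> nat) \<Rightarrow> complex. coeff_norm n m r a
        \<le> L ^ m * real n powr (real m / r - (real m + 1) / 2) * sup_norm n (hom_poly n m a)"
    by (intro exI[of _ 4] conjI allI impI ballI coeff_norm_le_complex) auto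
qed (use exponent_optimal[where 'k = real] exponent_optimal[where 'k = complex] in blast)+

end
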